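(* Let $v_1,\ldots,v_n$ be a basis of $\mathbb{R}^n$ and let $C=\operatorname{pos}(v_1,\ldots,v_n)$. Let $\mu:\mathcal{P}(\mathbb{R}^n)\to\mathbb{R}$ be an $\operatorname{O}(n)$-invariant valuation such that $\mu(D)=0$ for every $D\in\mathcal{P}(\mathbb{R}^n)$ which satisfies $\dim D<n$ or which contains a line. Let $\psi(a)=\mu(C(a))$ for $a\in\mathbb{R}_{>0}^n$. Then for every generic $u\in\mathbb{R}^n$, $$\mu(C)=\sum_{\pi\in S_n}\left(\prod_{k=1}^n\operatorname{sgn}\bigl((Q_\pi^Tu)_k\bigr)\right)\psi(|Q_\pi^Tu|).$$
   Context: $\operatorname{pos}$ denotes the set of nonnegative linear combinations and $\operatorname{lin}$ the linear span. $\mathcal{P}(\mathbb{R}^n)$ is the set of polyhedral cones in $\mathbb{R}^n$, i.e. sets $\operatorname{pos}(x_1,\ldots,x_m)$ with finitely many $x_i\in\mathbb{R}^n$ (the empty list gives $\{0\}$); the dimension of a cone is that of its linear span. A line is a one-dimensional linear subspace. A real valuation on $\mathcal{P}(\mathbb{R}^n)$ is a map $\mu:\mathcal{P}(\mathbb{R}^n)\to\mathbb{R}$ with $\mu(D\cup E)+\mu(D\cap E)=\mu(D)+\mu(E)$ whenever $D,E,D\cup E\in\mathcal{P}(\mathbb{R}^n)$; it is $\operatorname{O}(n)$-invariant if $\mu(gD)=\mu(D)$ for all $g\in\operatorname{O}(n)$ and all $D$. Standard orthoscheme cones: for $a\in\mathbb{R}^n$, with $e_1,\ldots,e_n$ the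 standard basis, $x_i(a)=\sum_{j=1}^i a_je_j$ and $C(a)=\operatorname{pos}(x_1(a),\ldots,x_n(a))$. Orthogonal frames: for a permutation $\pi\in S_n$, let $L_{\pi,0}=\{0\}$, $L_{\pi,k}=\operatorname{lin}(v_{\pi(1)},\ldots,v_{\pi(k)})$, and let $\Pi_L$ be orthogonal projection onto a subspace $L$. Put $$w_{\pi,k}=v_{\pi(k)}-\Pi_{L_{\pi,k-1}}(v_{\pi(k)}),\qquad q_{\pi,k}=\frac{w_{\pi,k}}{\|w_{\pi,k}\|},\qquad Q_\pi=[q_{\pi,1}\ \cdots\ q_{\pi,n}]\in\operatorname{O}(n)$$ (Gram–Schmidt applied to the reordered generators). A vector $u\in\mathbb{R}^n$ is called generic if $\langle u,q_{\pi,k}\rangle\ne0$ for every $\pi\in S_n$ and every $k\in\{1,\ldots,n\}$. For a vector $b$, $|b|$ denotes the coordinatewise absolute value. *)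

theory Defs
  imports "HOL-Analysis.Analysis"
begin

definition pos :: "'a::real_vector set \<Rightarrow> 'a set" where
  "pos S = {\<Sum>x\<in>T. c x *\<^sub>R x | T c. finite T \<and> T \<subseteq> S \<and> (\<forall>x\<in>T. 0 \<le> c x)}"

lemma pos_eq_convex_cone_hull: "pos S = convex_cone hull S"
proof (rule hull_unique[symmetric])
  show "S \<subseteq> pos S"
  proof
    fix x assume "x \<in> S"
    then show "x \<in> pos S"
      unfolding pos_def
      by (intro CollectI exI[of _ "{x}"] exI[of _ "\<lambda>_. 1::real"]) auto
  qed
  show "convex_cone (pos S)"
    unfolding convex_cone_iff
  proof (intro conjI ballI allI impI)
    show "0 \<in> pos S"
      unfolding pos_def by (intro CollectI exI[of _ "{}"]) auto
  next
    fix x y assume "x \<in> pos S" "y \<in> pos S"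
    then obtain T c U d where *: "x = (\<Sum>z\<in>T. c z *\<^sub>R z)" "finite T" "T \<subseteq> S" "\<forall>z\<in>T. 0 \<le> c z"
      "y = (\<Sum>z\<in>U. d z *\<^sub>R z)" "finite U" "U \<subseteq> S" "\<forall>z\<in>U. 0 \<le> d z"
      unfolding pos_def by auto
    define e where "e z = (if z \<in> T then c z else 0) + (if z \<in> U then d z else 0)" for z
    have "(\<Sum>z\<in>T \<union> U. (if z \<in> T then c z else 0) *\<^sub>R z) = x"
      unfolding *(1) using *(2,6) by (intro sum.mono_neutral_cong_right) auto
    moreover have "(\<Sum>z\<in>T \<union> U. (if z \<in> U then d z else 0) *\<^sub>R z) = y"
      unfolding *(5) using *(2,6) by (intro sum.mono_neutral_cong_right) auto
    ultimately have "x + y = (\<Sum>z\<in>T \<union> U. e z *\<^sub>R z)"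
      by (simp add: e_def scaleR_left_distrib sum.distrib)
    then show "x + y \<in> pos S"
      unfolding pos_def using *
      by (intro CollectI exI[of _ "T \<union> U"] exI[of _ e]) (auto simp: e_def)
  next
    fix x and t :: real assume "x \<in> pos S" "0 \<le> t"
    then obtain T c where *: "x = (\<Sum>z\<in>T. c z *\<^sub>R z)" "finite T" "T \<subseteq> S" "\<forall>z\<in>T. 0 \<le> c z"
      unfolding pos_def by auto
    then show "t *\<^sub>R x \<in> pos S"
      unfolding pos_def using \<open>0 \<le> t\<close>
      by (intro CollectI exI[of _ T] exI[of _ "\<lambda>z. t * c z"]) (auto simp: scaleR_sum_right)
  qed
next
  fix K assume K: "S \<subseteq> K" "convex_cone K"
  show "pos S \<subseteq> K"
  proof
    fix x assume "x \<in> pos S"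
    then obtain T c where x: "x = (\<Sum>z\<in>T. c z *\<^sub>R z)"
      and "finite T" "T \<subseteq> S" "\<forall>z\<in>T. 0 \<le> c z"
      unfolding pos_def by auto
    from this(2-) have "(\<Sum>z\<in>T. c z *\<^sub>R z) \<in> K"
      by (induction T rule: finite_induct) (use K in \<open>auto simp: convex_cone_iff subset_iff\<close>)
    then show "x \<in> K" using x by simp
  qed
qed

definition polyhedral_cones :: "'a::real_vector set set" where
  "polyhedral_cones = {pos S | S. finite S}"

definition contains_line :: "'a::euclidean_space set \<Rightarrow> bool" where
  "contains_line D \<longleftrightarrow> (\<exists>L. subspace L \<and> dim L = 1 \<and> L \<subseteq> D)"

text \<open>Valuations on cones are represented by total functions on sets; their values outside
  \<^const>\<open>polyhedral_cones\<close> are irrelevant.\<close>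

definition cone_valuation :: "('a::real_vector set \<Rightarrow> real) \<Rightarrow> bool" where
  "cone_valuation \<mu> \<longleftrightarrow>
     (\<forall>D\<in>polyhedral_cones. \<forall>E\<in>polyhedral_cones. D \<union> E \<in> polyhedral_cones \<longrightarrow>
        \<mu> (D \<union> E) + \<mu> (D \<inter> E) = \<mu> D + \<mu> E)"

definition orthogonal_invariant :: "((real^'n) set \<Rightarrow> real) \<Rightarrow> bool" where
  "orthogonal_invariant \<mu> \<longleftrightarrow>
     (\<forall>g :: real^'n^'n. orthogonal_matrix g \<longrightarrow>
        (\<forall>D\<in>polyhedral_cones. \<mu> ((\<lambda>x. g *v x) ` D) = \<mu> D))"

text \<open>The index set $1, \ldots, n$ is rendered by an arbitrary finite linearly ordered
  type \<^typ>\<open>'n\<close>, so that $n$ is \<^term>\<open>CARD('n)\<close>.\<close>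

definition orthoscheme_generator :: "real^'n::{finite,linorder} \<Rightarrow> 'n \<Rightarrow> real^'n::{finite,linorder}" where
  "orthoscheme_generator a i = (\<Sum>j\<in>{..i}. (a $ j) *\<^sub>R axis j 1)"

definition orthoscheme_cone :: "real^'n::{finite,linorder} \<Rightarrow> (real^'n::{finite,linorder}) set" where
  "orthoscheme_cone a = pos (range (orthoscheme_generator a))"

definition orth_proj :: "'a::euclidean_space set \<Rightarrow> 'a \<Rightarrow> 'a" where
  "orth_proj L x = (THE y. y \<in> L \<and> (\<forall>z\<in>L. orthogonal (x - y) z))"

lemma orth_proj:
  fixes L :: "'a::euclidean_space set"
  assumes "subspace L"
  shows "orth_proj L x \<in> L" and "\<And>z. z \<in> L \<Longrightarrow> orthogonal (x - orth_proj L x) z"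
proof -
  obtain y z where yz: "y \<in> span L" "\<And>w. w \<in> span L \<Longrightarrow> orthogonal z w" "x = y + z"
    using orthogonal_subspace_decomp_exists by blast
  have "\<exists>!y. y \<in> L \<and> (\<forall>z\<in>L. orthogonal (x - y) z)"
  proof (rule ex1I[of _ y])
    show "y \<in> L \<and> (\<forall>z\<in>L. orthogonal (x - y) z)"
      using yz assms by (auto simp: span_eq_iff[THEN iffD2])
  next
    fix y' assume y': "y' \<in> L \<and> (\<forall>z\<in>L. orthogonal (x - y') z)"
    have *: "y - y' \<in> L"
      using yz(1) y' assms by (metis span_eq_iff subspace_diff)
    moreover have "orthogonal (x - y) (y - y')"
      using yz * by (simp add: span_base)
    ultimately have "(y - y') \<bullet> (y - y') = 0"
      using y' by (auto simp: orthogonal_def inner_diff_left)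
    then show "y' = y" by simp
  qed
  from theI'[OF this]
  show "orth_proj L x \<in> L" "\<And>z. z \<in> L \<Longrightarrow> orthogonal (x - orth_proj L x) z"
    unfolding orth_proj_def by auto
qed

text \<open>The span of the generators strictly preceding position \<open>k\<close>; for the \<open>k\<close>-th position
  this is $L_{\pi,k-1}$, in particular it is $\{0\}$ for the first one.\<close>

definition frame_flag ::
    "('n \<Rightarrow> real^'n::{finite,linorder}) \<Rightarrow> ('n \<Rightarrow> 'n) \<Rightarrow> 'n \<Rightarrow> (real^'n::{finite,linorder}) set" where
  "frame_flag v \<pi> k = span ((\<lambda>j. v (\<pi> j)) ` {..<k})"

definition frame_w ::
    "('n \<Rightarrow> real^'n::{finite,linorder}) \<Rightarrow> ('n \<Rightarrow> 'n) \<Rightarrow> 'n \<Rightarrow> real^'n::{finite,linorder}" where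
  "frame_w v \<pi> k = v (\<pi> k) - orth_proj (frame_flag v \<pi> k) (v (\<pi> k))"

definition frame_q ::
    "('n \<Rightarrow> real^'n::{finite,linorder}) \<Rightarrow> ('n \<Rightarrow> 'n) \<Rightarrow> 'n \<Rightarrow> real^'n::{finite,linorder}" where
  "frame_q v \<pi> k = (1 / norm (frame_w v \<pi> k)) *\<^sub>R frame_w v \<pi> k"

definition frame_Q ::
    "('n \<Rightarrow> real^'n::{finite,linorder}) \<Rightarrow> ('n \<Rightarrow> 'n) \<Rightarrow> real^'n::{finite,linorder}^'n::{finite,linorder}" where
  "frame_Q v \<pi> = (\<chi> i k. frame_q v \<pi> k $ i)"

definition generic :: "('n \<Rightarrow> real^'n::{finite,linorder}) \<Rightarrow> real^'n::{finite,linorder} \<Rightarrow> bool" where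
  "generic v u \<longleftrightarrow> (\<forall>\<pi>. \<pi> permutes UNIV \<longrightarrow> (\<forall>k. u \<bullet> frame_q v \<pi> k \<noteq> 0))"

end

theory Submission
  imports Defs
begin

text \<open>
  For a linearly independent family \<open>x\<close>, reflecting one generator changes the sign of
  \<open>\<mu> (pos (range x))\<close>, because the two cones together form a cone containing a line. Splitting a
  cone along \<open>x i + x j\<close> and iterating gives, for \<open>b = (\<Sum>i\<in>S. \<beta> i *\<^sub>R x i)\<close> with all \<open>\<beta> i \<noteq> 0\<close>, the
  exchange relation \<open>\<mu> (pos (range x)) = (\<Sum>i\<in>S. sgn (\<beta> i) * \<mu> (pos (range (x(i := b)))))\<close>.
  Now replace generators one at a time, from the top position of the flag downwards: at position
  \<open>m\<close>, use as \<open>b\<close> the projection of \<open>u\<close> to the span of the generators that have not been replaced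
  yet. The coefficient of the generator being replaced has the sign of \<open>u \<bullet> q\<^sub>m\<close>. At the end the
  generators are the projections \<open>\<Sum>j\<le>k. (u \<bullet> q\<^sub>j) *\<^sub>R q\<^sub>j\<close> of \<open>u\<close> to the members of the flag, and these
  span an isometric image of the orthoscheme cone of \<open>\<bar>Q\<^sup>T u\<bar>\<close>.
\<close>

subsection \<open>Cones generated by finite families\<close>

text \<open>A family may repeat vectors, whereas \<open>pos\<close> sums over a set. One inclusion
  picks one index per vector and pads with zero coefficients; the other uses that the convex cone
  hull is closed under addition and scaling.\<close>

lemma pos_image:
  assumes "finite I"
  shows "pos (x ` I) = {\<Sum>i\<in>I. c i *\<^sub>R x i | c. \<forall>i\<in>I. 0 \<le> c i}"
proof (intro set_eqI iffI)
  fix y assume "y \<in> pos (x ` I)"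
  then obtain T c where y: "y = (\<Sum>z\<in>T. c z *\<^sub>R z)" "T \<subseteq> x ` I" "\<forall>z\<in>T. 0 \<le> c z"
    unfolding pos_def by auto
  then obtain J where J: "J \<subseteq> I" "inj_on x J" "T = x ` J"
    unfolding subset_image_inj by blast
  let ?d = "\<lambda>i. if i \<in> J then c (x i) else 0"
  have "y = (\<Sum>i\<in>J. c (x i) *\<^sub>R x i)"
    unfolding y(1) J(3) using J(2) by (simp add: sum.reindex)
  also have "\<dots> = (\<Sum>i\<in>I. ?d i *\<^sub>R x i)"
    using J(1) assms by (intro sum.mono_neutral_cong_left) auto
  finally show "y \<in> {\<Sum>i\<in>I. c i *\<^sub>R x i | c. \<forall>i\<in>I. 0 \<le> c i}"
    using y(3) J(3) by (intro CollectI exI[of _ ?d]) auto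
next
  fix y assume "y \<in> {\<Sum>i\<in>I. c i *\<^sub>R x i | c. \<forall>i\<in>I. 0 \<le> c i}"
  then obtain c where y: "y = (\<Sum>i\<in>I. c i *\<^sub>R x i)" and c: "\<forall>i\<in>I. 0 \<le> c i"
    by auto
  have "(\<Sum>i\<in>J. c i *\<^sub>R x i) \<in> convex_cone hull (x ` I)" if "finite J" "J \<subseteq> I" for J
    using that
    by (induction J rule: finite_induct)
      (use c in \<open>auto intro!: convex_cone_hull_add convex_cone_hull_mul
          simp: convex_cone_hull_contains_0 hull_inc\<close>)
  then show "y \<in> pos (x ` I)"
    using assms by (simp add: y pos_eq_convex_cone_hull)
qed

text \<open>Cones are indexed by families so that exchanging a single generator is a function
  update.\<close>

definition gen_cone :: "('i::finite \<Rightarrow> 'a::real_vector) \<Rightarrow> 'a set" where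
  "gen_cone x = pos (range x)"

lemma gen_cone_altdef:
  fixes x :: "'i::finite \<Rightarrow> 'a::real_vector"
  shows "gen_cone x = {\<Sum>i\<in>UNIV. c i *\<^sub>R x i | c. \<forall>i. 0 \<le> c i}"
  by (simp add: gen_cone_def pos_image)

lemma pos_linear_image: "linear f \<Longrightarrow> pos (f ` S) = f ` pos S"
  by (simp add: pos_eq_convex_cone_hull convex_cone_hull_linear_image)

lemma pos_mono: "S \<subseteq> T \<Longrightarrow> pos S \<subseteq> pos T"
  by (simp add: pos_eq_convex_cone_hull hull_mono)

lemma polyhedral_cones_pos [simp]: "finite S \<Longrightarrow> pos S \<in> polyhedral_cones"
  unfolding polyhedral_cones_def by auto

lemma polyhedral_cones_gen_cone [simp]: "gen_cone x \<in> polyhedral_cones"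
  by (simp add: gen_cone_def)

lemma pos_subset_span: "pos S \<subseteq> span S"
  by (auto simp: pos_def intro!: span_sum span_scale intro: span_base)

text \<open>A zero generator encodes an omitted one while the index type stays the same. The
  lower-dimensional intersections arising below have this form, and \<open>\<mu>\<close> vanishes on
  them.\<close>

lemma dim_gen_cone_less:
  fixes x :: "'i::finite \<Rightarrow> 'a::euclidean_space"
  assumes "x i = 0"
  shows "dim (gen_cone x) < CARD('i)"
proof -
  have "range x = insert 0 (x ` (- {i}))"
    using assms by (auto simp: image_iff)
  then have "gen_cone x \<subseteq> span (x ` (- {i}))"
    using pos_subset_span[of "range x"] by (simp add: gen_cone_def)
  then have "dim (gen_cone x) \<le> card (x ` (- {i}))"
    by (intro dim_le_card) auto
  also have "\<dots> \<le> card (- {i})"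
    by (simp add: card_image_le)
  also have "\<dots> < card (UNIV :: 'i set)"
    by (rule psubset_card_mono) auto
  finally show ?thesis .
qed

section \<open>Linear independence of families and exchange of one generator\<close>

definition lin_indep :: "('i::finite \<Rightarrow> 'a::real_vector) \<Rightarrow> bool" where
  "lin_indep x \<longleftrightarrow> (\<forall>c. (\<Sum>i\<in>UNIV. c i *\<^sub>R x i) = 0 \<longrightarrow> (\<forall>i. c i = 0))"

lemma lin_indepD:
  assumes "lin_indep x" "(\<Sum>i\<in>UNIV. c i *\<^sub>R x i) = (\<Sum>i\<in>UNIV. d i *\<^sub>R x i)"
  shows "c = d"
proof -
  have "(\<Sum>i\<in>UNIV. (c i - d i) *\<^sub>R x i) = 0"
    using assms(2) by (simp add: scaleR_left_diff_distrib sum_subtractf)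
  then show ?thesis
    using assms(1) unfolding lin_indep_def by fastforce
qed

lemma lin_indep_inj_independent:
  assumes "inj x" "independent (range x)"
  shows "lin_indep x"
  unfolding lin_indep_def
proof (intro allI impI)
  fix c i assume c: "(\<Sum>i\<in>UNIV. c i *\<^sub>R x i) = 0"
  have "(\<Sum>y\<in>range x. c (inv x y) *\<^sub>R y) = 0"
    using c assms(1) by (simp add: sum.reindex)
  then have "c (inv x (x i)) = 0"
    using independentD[OF assms(2), of "range x" "\<lambda>y. c (inv x y)" "x i"] by simp
  then show "c i = 0"
    using assms(1) by simp
qed

lemma lin_indep_bij:
  assumes "lin_indep x" "bij f"
  shows "lin_indep (x \<circ> f)"
  unfolding lin_indep_def
proof (intro allI impI)
  fix c i assume c: "(\<Sum>i\<in>UNIV. c i *\<^sub>R (x \<circ> f) i) = 0"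
  have "(\<Sum>i\<in>UNIV. c (inv f i) *\<^sub>R x i) = (\<Sum>i\<in>UNIV. c (inv f (f i)) *\<^sub>R x (f i))"
    using assms(2) by (rule sum.reindex_bij_betw[symmetric])
  also have "\<dots> = 0"
    using c assms(2) by (simp add: bij_is_inj)
  finally have "c (inv f (f i)) = 0"
    using assms(1) unfolding lin_indep_def by fast
  then show "c i = 0"
    using assms(2) by (simp add: bij_is_inj)
qed

text \<open>This is the change of coordinates behind the computations with exchanged generators:
  coefficients with respect to the updated family become coefficients with respect to
  \<open>x\<close>.\<close>

lemma sum_update:
  fixes x :: "'i::finite \<Rightarrow> 'a::real_vector"
  shows "(\<Sum>k\<in>UNIV. c k *\<^sub>R (x(i := \<Sum>k\<in>UNIV. b k *\<^sub>R x k)) k)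
       = (\<Sum>k\<in>UNIV. ((c(i := 0)) k + c i * b k) *\<^sub>R x k)"
proof -
  let ?b = "\<Sum>k\<in>UNIV. b k *\<^sub>R x k"
  have "(\<Sum>k\<in>UNIV. c k *\<^sub>R (x(i := ?b)) k) = c i *\<^sub>R ?b + (\<Sum>k\<in>UNIV - {i}. c k *\<^sub>R x k)"
    by (subst sum.remove[of _ i]) (auto intro!: sum.cong)
  also have "(\<Sum>k\<in>UNIV - {i}. c k *\<^sub>R x k) = (\<Sum>k\<in>UNIV. (c(i := 0)) k *\<^sub>R x k)"
    by (intro sum.mono_neutral_cong_left) auto
  finally show ?thesis
    by (simp add: scaleR_left_distrib sum.distrib scaleR_sum_right)
qed

lemma lin_indep_update:
  assumes x: "lin_indep x" and b: "b = (\<Sum>k\<in>UNIV. \<beta> k *\<^sub>R x k)" and "\<beta> i \<noteq> 0"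
  shows "lin_indep (x(i := b))"
  unfolding lin_indep_def
proof (intro allI impI)
  fix c k assume "(\<Sum>k\<in>UNIV. c k *\<^sub>R (x(i := b)) k) = 0"
  then have *: "(c(i := 0)) k + c i * \<beta> k = 0" for k
    using x unfolding b sum_update lin_indep_def by fast
  have "c i = 0"
    using *[of i] \<open>\<beta> i \<noteq> 0\<close> by simp
  then show "c k = 0"
    using *[of k] by (cases "k = i") auto
qed

lemma lin_indep_scale:
  assumes "lin_indep x" "\<And>i. \<gamma> i \<noteq> (0::real)"
  shows "lin_indep (\<lambda>i. \<gamma> i *\<^sub>R x i)"
  unfolding lin_indep_def
proof (intro allI impI)
  fix c i assume "(\<Sum>i\<in>UNIV. c i *\<^sub>R \<gamma> i *\<^sub>R x i) = 0"
  then have "(\<Sum>i\<in>UNIV. (c i * \<gamma> i) *\<^sub>R x i) = 0"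
    by simp
  then have "c i * \<gamma> i = 0"
    using assms(1) unfolding lin_indep_def by fast
  then show "c i = 0"
    using assms(2)[of i] by simp
qed

section \<open>Cutting a cone along the sum of two generators\<close>

lemma sum_coeff_pair:
  fixes x :: "'i::finite \<Rightarrow> 'a::real_vector"
  assumes "i \<noteq> j"
  shows "x i + x j = (\<Sum>k\<in>UNIV. (if k = i \<or> k = j then 1 else 0) *\<^sub>R x k)"
proof -
  have "(\<Sum>k\<in>UNIV. (if k = i \<or> k = j then 1 else 0) *\<^sub>R x k) = (\<Sum>k\<in>{i, j}. x k)"
    by (intro sum.mono_neutral_cong_right) auto
  then show ?thesis
    using assms by simp
qed

text \<open>The sum \<open>c i *\<^sub>R (x i + x j) + c j *\<^sub>R x j\<close> has coordinates
  \<open>c i\<close> and \<open>c i + c j\<close>, so nonnegative coefficients give exactly the part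
  of the cone where the coordinate at \<open>i\<close> is at most the one at
  \<open>j\<close>.\<close>

lemma gen_cone_sum_update:
  fixes x :: "'i::finite \<Rightarrow> 'a::real_vector"
  assumes "i \<noteq> j"
  shows "gen_cone (x(i := x i + x j))
       = {\<Sum>k\<in>UNIV. c k *\<^sub>R x k | c. (\<forall>k. 0 \<le> c k) \<and> c i \<le> c j}" (is "_ = ?R")
proof (intro set_eqI iffI)
  fix y assume "y \<in> gen_cone (x(i := x i + x j))"
  then obtain c where c: "\<forall>k. 0 \<le> c k" and "y = (\<Sum>k\<in>UNIV. c k *\<^sub>R (x(i := x i + x j)) k)"
    by (auto simp: gen_cone_altdef)
  then have "y = (\<Sum>k\<in>UNIV. ((c(i := 0)) k + c i * (if k = i \<or> k = j then 1 else 0)) *\<^sub>R x k)"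
    by (simp only: sum_coeff_pair[OF assms] sum_update)
  then show "y \<in> ?R"
    using c assms
    by (intro CollectI exI[of _ "\<lambda>k. (c(i := 0)) k + c i * (if k = i \<or> k = j then 1 else 0)"]) auto
next
  fix y assume "y \<in> ?R"
  then obtain c where c: "\<forall>k. 0 \<le> c k" "c i \<le> c j" and y: "y = (\<Sum>k\<in>UNIV. c k *\<^sub>R x k)"
    by auto
  have "(\<Sum>k\<in>UNIV. (c(j := c j - c i)) k *\<^sub>R (x(i := x i + x j)) k) = y"
    unfolding sum_coeff_pair[OF assms] sum_update y using assms by (intro sum.cong) auto
  then show "y \<in> gen_cone (x(i := x i + x j))"
    unfolding gen_cone_altdef using c
    by (intro CollectI exI[of _ "c(j := c j - c i)"]) auto
qed

lemma gen_cone_sum_update_Un: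
  fixes x :: "'i::finite \<Rightarrow> 'a::real_vector"
  assumes "i \<noteq> j"
  shows "gen_cone (x(i := x i + x j)) \<union> gen_cone (x(j := x i + x j)) = gen_cone x"
  using assms gen_cone_sum_update[OF assms, of x] gen_cone_sum_update[OF assms[symmetric], of x]
  by (auto simp: gen_cone_altdef[of x] add.commute) (metis linear)

text \<open>By independence a common point has only one coordinate vector, which satisfies both
  inequalities. Hence its coordinates at \<open>i\<close> and \<open>j\<close> agree, and
  \<open>x i + x j\<close> takes the place of both generators.\<close>

lemma gen_cone_sum_update_Int:
  fixes x :: "'i::finite \<Rightarrow> 'a::real_vector"
  assumes ij: "i \<noteq> j" and x: "lin_indep x"
  shows "gen_cone (x(i := x i + x j)) \<inter> gen_cone (x(j := x i + x j))
       = gen_cone (x(i := x i + x j, j := 0))" (is "?L = ?R")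
proof (intro set_eqI iffI)
  fix y assume "y \<in> ?L"
  then obtain c d where c: "\<forall>k. 0 \<le> c k" "c i \<le> c j" "y = (\<Sum>k\<in>UNIV. c k *\<^sub>R x k)"
    and d: "d j \<le> d i" "y = (\<Sum>k\<in>UNIV. d k *\<^sub>R x k)"
    using gen_cone_sum_update[OF ij, of x] gen_cone_sum_update[OF ij[symmetric], of x]
    by (auto simp: add.commute)
  have "c = d"
    using x c(3) d(2) by (metis lin_indepD)
  then have cij: "c i = c j"
    using c d by auto
  have "(\<Sum>k\<in>UNIV. c k *\<^sub>R (x(i := x i + x j, j := 0)) k)
      = (\<Sum>k\<in>UNIV. (c(j := 0)) k *\<^sub>R (x(i := x i + x j)) k)"
    by (intro sum.cong) auto
  also have "\<dots> = y"
    unfolding sum_coeff_pair[OF ij] sum_update c(3) using ij cij by (intro sum.cong) auto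
  finally show "y \<in> ?R"
    unfolding gen_cone_altdef using c(1) by auto
next
  fix y assume "y \<in> ?R"
  then obtain c where c: "\<forall>k. 0 \<le> c k"
    and y: "y = (\<Sum>k\<in>UNIV. c k *\<^sub>R (x(i := x i + x j, j := 0)) k)"
    by (auto simp: gen_cone_altdef)
  have "y = (\<Sum>k\<in>UNIV. (c(j := 0)) k *\<^sub>R (x(i := x i + x j)) k)"
    unfolding y by (intro sum.cong) auto
  also have "\<dots> = (\<Sum>k\<in>UNIV. (c(j := c i)) k *\<^sub>R x k)"
    unfolding sum_coeff_pair[OF ij] sum_update using ij by (intro sum.cong) auto
  finally have "\<exists>d. y = (\<Sum>k\<in>UNIV. d k *\<^sub>R x k) \<and> (\<forall>k. 0 \<le> d k) \<and> d i = d j"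
    using c ij by (intro exI[of _ "c(j := c i)"]) auto
  then show "y \<in> ?L"
    using gen_cone_sum_update[OF ij, of x] gen_cone_sum_update[OF ij[symmetric], of x]
    by (auto simp: add.commute)
qed

section \<open>Rescaling and reflecting one generator\<close>

lemma sum_scale_update:
  fixes x :: "'i::finite \<Rightarrow> 'a::real_vector"
  shows "(\<Sum>k\<in>UNIV. c k *\<^sub>R (x(i := t *\<^sub>R x i)) k) = (\<Sum>k\<in>UNIV. (c(i := t * c i)) k *\<^sub>R x k)"
  by (intro sum.cong) auto

lemma gen_cone_scale_update:
  fixes x :: "'i::finite \<Rightarrow> 'a::real_vector"
  assumes "0 < t"
  shows "gen_cone (x(i := t *\<^sub>R x i)) = gen_cone x"
proof -
  have *: "gen_cone (x(i := t *\<^sub>R x i)) \<subseteq> gen_cone x" if "0 < t"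
    for t and x :: "'i \<Rightarrow> 'a"
    unfolding gen_cone_altdef sum_scale_update
  proof (safe)
    fix c :: "'i \<Rightarrow> real" assume "\<forall>i. 0 \<le> c i"
    then show "\<exists>d. (\<Sum>k\<in>UNIV. (c(i := t * c i)) k *\<^sub>R x k) = (\<Sum>k\<in>UNIV. d k *\<^sub>R x k) \<and> (\<forall>i. 0 \<le> d i)"
      using that by (intro exI[of _ "c(i := t * c i)"]) auto
  qed
  have "gen_cone x \<subseteq> gen_cone (x(i := t *\<^sub>R x i))"
    using *[of "1 / t" "x(i := t *\<^sub>R x i)"] assms by simp
  then show ?thesis
    using *[OF assms] by blast
qed

lemma gen_cone_minus_update:
  fixes x :: "'i::finite \<Rightarrow> 'a::real_vector"
  shows "gen_cone (x(i := - x i)) = {\<Sum>k\<in>UNIV. c k *\<^sub>R x k | c. (\<forall>k. k \<noteq> i \<longrightarrow> 0 \<le> c k) \<and> c i \<le> 0}"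
proof -
  have "gen_cone (x(i := - x i)) = {\<Sum>k\<in>UNIV. (c(i := - c i)) k *\<^sub>R x k | c. \<forall>k. 0 \<le> c k}"
    using sum_scale_update[of _ x i "-1"] by (simp add: gen_cone_altdef)
  also have "\<dots> = {\<Sum>k\<in>UNIV. c k *\<^sub>R x k | c. (\<forall>k. k \<noteq> i \<longrightarrow> 0 \<le> c k) \<and> c i \<le> 0}"
  proof safe
    fix c :: "'i \<Rightarrow> real" assume "\<forall>k. 0 \<le> c k"
    then show "\<exists>d. (\<Sum>k\<in>UNIV. (c(i := - c i)) k *\<^sub>R x k) = (\<Sum>k\<in>UNIV. d k *\<^sub>R x k) \<and>
        (\<forall>k. k \<noteq> i \<longrightarrow> 0 \<le> d k) \<and> d i \<le> 0"
      by (intro exI[of _ "c(i := - c i)"]) auto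
  next
    fix c :: "'i \<Rightarrow> real" assume "\<forall>k. k \<noteq> i \<longrightarrow> 0 \<le> c k" "c i \<le> 0"
    then show "\<exists>d. (\<Sum>k\<in>UNIV. c k *\<^sub>R x k) = (\<Sum>k\<in>UNIV. (d(i := - d i)) k *\<^sub>R x k) \<and> (\<forall>k. 0 \<le> d k)"
      by (intro exI[of _ "c(i := - c i)"]) auto
  qed
  finally show ?thesis .
qed

text \<open>Both sides consist of the combinations whose coefficient at \<open>i\<close> has
  arbitrary sign. This set is a convex cone, which gives the nontrivial inclusion by minimality of
  the hull. The right-hand form shows that the union is polyhedral and contains the line through
  \<open>x i\<close>.\<close>

lemma gen_cone_minus_update_Un:
  fixes x :: "'i::finite \<Rightarrow> 'a::real_vector"
  shows "gen_cone x \<union> gen_cone (x(i := - x i)) = pos (insert (- x i) (range x))" (is "?L = ?R")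
proof
  show "?L \<subseteq> ?R"
    unfolding gen_cone_def by (intro Un_least pos_mono) auto
  have L: "?L = {\<Sum>k\<in>UNIV. c k *\<^sub>R x k | c. \<forall>k. k \<noteq> i \<longrightarrow> 0 \<le> c k}" (is "_ = ?U")
    unfolding gen_cone_minus_update unfolding gen_cone_altdef by (auto; metis linear)
  have "convex_cone ?U"
    unfolding convex_cone_iff
  proof (intro conjI ballI allI impI)
    show "0 \<in> ?U"
      by (intro CollectI exI[of _ "\<lambda>_. 0"]) auto
  next
    fix y z assume "y \<in> ?U" "z \<in> ?U"
    then obtain c d where "y = (\<Sum>k\<in>UNIV. c k *\<^sub>R x k)" "z = (\<Sum>k\<in>UNIV. d k *\<^sub>R x k)"
      "\<forall>k. k \<noteq> i \<longrightarrow> 0 \<le> c k" "\<forall>k. k \<noteq> i \<longrightarrow> 0 \<le> d k"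
      by auto
    then show "y + z \<in> ?U"
      by (intro CollectI exI[of _ "\<lambda>k. c k + d k"]) (auto simp: scaleR_left_distrib sum.distrib)
  next
    fix y and t :: real assume "y \<in> ?U" "0 \<le> t"
    then obtain c where "y = (\<Sum>k\<in>UNIV. c k *\<^sub>R x k)" "\<forall>k. k \<noteq> i \<longrightarrow> 0 \<le> c k"
      by auto
    then show "t *\<^sub>R y \<in> ?U"
      using \<open>0 \<le> t\<close>
      by (intro CollectI exI[of _ "\<lambda>k. t * c k"]) (auto simp: scaleR_sum_right)
  qed
  moreover have "insert (- x i) (range x) \<subseteq> ?L"
  proof -
    have S: "S \<subseteq> pos S" for S :: "'a set"
      by (simp add: pos_eq_convex_cone_hull hull_subset)
    have "- x i \<in> range (x(i := - x i))"
      by (metis fun_upd_same rangeI)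
    then show ?thesis
      using S[of "range x"] S[of "range (x(i := - x i))"] unfolding gen_cone_def by blast
  qed
  ultimately show "?R \<subseteq> ?L"
    unfolding L pos_eq_convex_cone_hull[of "insert _ _"] by (intro hull_minimal)
qed

text \<open>Coordinates are unique, so the one at \<open>i\<close> is both nonnegative and
  nonpositive on the intersection.\<close>

lemma gen_cone_minus_update_Int:
  fixes x :: "'i::finite \<Rightarrow> 'a::real_vector"
  assumes x: "lin_indep x"
  shows "gen_cone x \<inter> gen_cone (x(i := - x i)) = gen_cone (x(i := 0))" (is "?L = ?R")
proof (intro set_eqI iffI)
  fix y assume "y \<in> ?L"
  then obtain c d where c: "\<forall>k. 0 \<le> c k" "y = (\<Sum>k\<in>UNIV. c k *\<^sub>R x k)"
    and d: "d i \<le> 0" "y = (\<Sum>k\<in>UNIV. d k *\<^sub>R x k)"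
    unfolding gen_cone_minus_update unfolding gen_cone_altdef by auto
  have "c = d"
    using x c(2) d(2) by (metis lin_indepD)
  then have "c i = 0"
    using c d by (metis order_antisym)
  then have "y = (\<Sum>k\<in>UNIV. c k *\<^sub>R (x(i := 0)) k)"
    unfolding c(2) by (intro sum.cong) auto
  then show "y \<in> ?R"
    unfolding gen_cone_altdef using c(1) by auto
next
  fix y assume "y \<in> ?R"
  then obtain c where c: "\<forall>k. 0 \<le> c k" "y = (\<Sum>k\<in>UNIV. c k *\<^sub>R (x(i := 0)) k)"
    unfolding gen_cone_altdef by auto
  have "y = (\<Sum>k\<in>UNIV. (c(i := 0)) k *\<^sub>R x k)"
    unfolding c(2) by (intro sum.cong) auto
  then have "\<exists>d. y = (\<Sum>k\<in>UNIV. d k *\<^sub>R x k) \<and> (\<forall>k. 0 \<le> d k) \<and> d i = 0"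
    using c(1) by (intro exI[of _ "c(i := 0)"]) auto
  then show "y \<in> ?L"
    unfolding gen_cone_minus_update unfolding gen_cone_altdef by auto
qed

subsection \<open>The exchange relation\<close>

text \<open>The exchange relation rests on these two properties; orthogonal invariance enters at the
  end, when the final cones are identified with orthoscheme cones.\<close>

locale simple_cone_valuation =
  fixes \<mu> :: "(real^'n::finite) set \<Rightarrow> real"
  assumes valuation: "cone_valuation \<mu>"
    and vanish: "D \<in> polyhedral_cones \<Longrightarrow> dim D < CARD('n) \<or> contains_line D \<Longrightarrow> \<mu> D = 0"
begin

text \<open>The two pieces overlap in a cone of dimension below \<open>CARD('n)\<close>, so
  \<open>\<mu>\<close> is additive on this cut.\<close>

lemma measure_sum_update:
  fixes x :: "'n \<Rightarrow> real^'n"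
  assumes ij: "i \<noteq> j" and x: "lin_indep x"
  shows "\<mu> (gen_cone x)
       = \<mu> (gen_cone (x(i := x i + x j))) + \<mu> (gen_cone (x(j := x i + x j)))"
proof -
  have "\<mu> (gen_cone (x(i := x i + x j, j := 0))) = 0"
    by (intro vanish disjI1 dim_gen_cone_less[of _ j]) auto
  moreover have "\<mu> (gen_cone x) + \<mu> (gen_cone (x(i := x i + x j, j := 0)))
      = \<mu> (gen_cone (x(i := x i + x j))) + \<mu> (gen_cone (x(j := x i + x j)))"
    using valuation gen_cone_sum_update_Un[OF ij, of x] gen_cone_sum_update_Int[OF ij x]
    unfolding cone_valuation_def by (metis polyhedral_cones_gen_cone)
  ultimately show ?thesis
    by simp
qed

lemma measure_minus_update:
  fixes x :: "'n \<Rightarrow> real^'n"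
  assumes x: "lin_indep x"
  shows "\<mu> (gen_cone (x(i := - x i))) = - \<mu> (gen_cone x)"
proof -
  have "x i \<noteq> 0"
  proof
    assume "x i = 0"
    then have "(\<Sum>k\<in>UNIV. (if k = i then 1 else 0) *\<^sub>R x k) = 0"
      by (intro sum.neutral) auto
    from lin_indep_def[THEN iffD1, OF x, rule_format, OF this, of i] show False
      by simp
  qed
  moreover have "span {x i} \<subseteq> pos (insert (- x i) (range x))"
  proof
    fix y assume "y \<in> span {x i}"
    then obtain t where y: "y = t *\<^sub>R x i"
      by (auto simp: span_singleton)
    have "\<bar>t\<bar> *\<^sub>R x i \<in> pos (insert (- x i) (range x))"
      "\<bar>t\<bar> *\<^sub>R (- x i) \<in> pos (insert (- x i) (range x))"
      unfolding pos_eq_convex_cone_hull by (intro convex_cone_hull_mul hull_inc; simp)+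
    then show "y \<in> pos (insert (- x i) (range x))"
      by (cases "0 \<le> t") (auto simp: y)
  qed
  ultimately have "contains_line (pos (insert (- x i) (range x)))"
    unfolding contains_line_def by (intro exI[of _ "span {x i}"]) (simp add: dim_span)
  then have "\<mu> (pos (insert (- x i) (range x))) = 0"
    by (intro vanish) auto
  moreover have "\<mu> (gen_cone (x(i := 0))) = 0"
    by (intro vanish disjI1 dim_gen_cone_less[of _ i]) auto
  moreover have "\<mu> (pos (insert (- x i) (range x))) + \<mu> (gen_cone (x(i := 0)))
      = \<mu> (gen_cone x) + \<mu> (gen_cone (x(i := - x i)))"
    using valuation gen_cone_minus_update_Un[of x i] gen_cone_minus_update_Int[OF x, of i]
    unfolding cone_valuation_def by (metis polyhedral_cones_gen_cone polyhedral_cones_pos finite_insert finite_imageI finite)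
  ultimately show ?thesis
    by simp
qed

lemma measure_scale_update:
  fixes x :: "'n \<Rightarrow> real^'n"
  assumes x: "lin_indep x" and "t \<noteq> 0"
  shows "\<mu> (gen_cone (x(i := t *\<^sub>R x i))) = sgn t * \<mu> (gen_cone x)"
proof (cases "0 < t")
  case True
  then show ?thesis
    by (simp add: gen_cone_scale_update)
next
  case False
  then have "0 < - t"
    using assms by simp
  from gen_cone_scale_update[OF this, of "x(i := - x i)" i] show ?thesis
    using measure_minus_update[OF x, of i] False assms(2) by simp
qed

text \<open>The generators are rescaled one at a time, each contributing its sign; \<open>S\<close>
  is the set of indices already treated.\<close>

lemma measure_scale:
  fixes x :: "'n \<Rightarrow> real^'n"
  assumes x: "lin_indep x" and \<gamma>: "\<And>i. \<gamma> i \<noteq> 0"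
  shows "\<mu> (gen_cone (\<lambda>i. \<gamma> i *\<^sub>R x i)) = (\<Prod>i\<in>UNIV. sgn (\<gamma> i)) * \<mu> (gen_cone x)"
proof -
  have "\<mu> (gen_cone (\<lambda>i. (if i \<in> S then \<gamma> i else 1) *\<^sub>R x i))
      = (\<Prod>i\<in>S. sgn (\<gamma> i)) * \<mu> (gen_cone x)" if "finite S" for S
    using that
  proof (induction S rule: finite_induct)
    case (insert a S)
    let ?y = "\<lambda>i. (if i \<in> S then \<gamma> i else 1) *\<^sub>R x i"
    have "lin_indep ?y"
      using \<gamma> by (intro lin_indep_scale x) auto
    moreover have "(\<lambda>i. (if i \<in> insert a S then \<gamma> i else 1) *\<^sub>R x i) = ?y(a := \<gamma> a *\<^sub>R ?y a)"
      using insert.hyps by auto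
    ultimately show ?case
      using insert measure_scale_update[of ?y "\<gamma> a" a] \<gamma> by (simp only:) simp
  qed simp
  from this[of UNIV] show ?thesis
    by simp
qed

text \<open>Stellar subdivision at the sum of the generators in \<open>S\<close>, built by induction
  from cuts along two generators. Passing from \<open>S\<close> to \<open>insert a S\<close> refines
  the subdivision at \<open>?b'\<close> to the one at \<open>?b = x a + ?b'\<close>.\<close>

lemma measure_stellar:
  fixes x :: "'n \<Rightarrow> real^'n"
  assumes "S \<noteq> {}" "lin_indep x"
  shows "\<mu> (gen_cone x) = (\<Sum>i\<in>S. \<mu> (gen_cone (x(i := \<Sum>k\<in>S. x k))))"
  using finite[of S] assms
proof (induction S arbitrary: x rule: finite_ne_induct)
  case (insert a S)
  let ?b' = "\<Sum>k\<in>S. x k" and ?b = "x a + (\<Sum>k\<in>S. x k)"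
  have sum_S: "(\<Sum>k\<in>T. x k) = (\<Sum>k\<in>UNIV. (if k \<in> T then 1 else 0) *\<^sub>R x k)" for T
    by (intro sum.mono_neutral_cong_left) auto
  have "?b = (\<Sum>k\<in>insert a S. x k)"
    using insert.hyps by simp
  then have indep_b: "lin_indep (x(a := ?b))"
    using lin_indep_update[OF insert.prems(1) sum_S[of "insert a S"], of a] by simp
  \<comment> \<open>Each piece of the old subdivision is cut along its generators \<open>x a\<close>
    and \<open>?b'\<close>, whose sum is \<open>?b\<close>. The halves that received
    \<open>?b\<close> at \<open>a\<close> are the pieces of the subdivision of
    \<open>x(a := ?b)\<close> at \<open>?b'\<close>, so the induction hypothesis reassembles
    them.\<close>
  have *: "\<mu> (gen_cone (x(i := ?b'))) = \<mu> (gen_cone (x(a := ?b, i := ?b'))) +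
      \<mu> (gen_cone (x(i := ?b)))" if "i \<in> S" for i
  proof -
    have ai: "a \<noteq> i"
      using insert.hyps that by auto
    have "lin_indep (x(i := ?b'))"
      using lin_indep_update[OF insert.prems(1) sum_S[of S], of i] that by simp
    from measure_sum_update[OF ai this] show ?thesis
      using ai by (simp add: fun_upd_twist)
  qed
  have "(\<Sum>k\<in>S. (x(a := ?b)) k) = ?b'"
    using insert.hyps by (intro sum.cong) auto
  then have IH: "\<mu> (gen_cone (x(a := ?b))) = (\<Sum>i\<in>S. \<mu> (gen_cone (x(a := ?b, i := ?b'))))"
    using insert.IH[OF indep_b] by (simp only:)
  have "\<mu> (gen_cone x) = (\<Sum>i\<in>S. \<mu> (gen_cone (x(i := ?b'))))"
    by (rule insert.IH[OF insert.prems(1)])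
  also have "\<dots> = \<mu> (gen_cone (x(a := ?b))) + (\<Sum>i\<in>S. \<mu> (gen_cone (x(i := ?b))))"
    by (simp add: * IH sum.distrib)
  finally show ?case
    by (simp only: sum.insert[OF insert.hyps(1,3)])
qed simp

text \<open>After rescaling the generators in \<open>S\<close> by their coefficients,
  \<open>b\<close> is their plain sum and stellar subdivision applies. The signs produced by the
  rescaling are then cancelled from both sides.\<close>

lemma measure_exchange:
  fixes x :: "'n \<Rightarrow> real^'n"
  assumes S: "S \<noteq> {}" and x: "lin_indep x" and b: "b = (\<Sum>k\<in>S. \<beta> k *\<^sub>R x k)"
    and \<beta>: "\<And>k. k \<in> S \<Longrightarrow> \<beta> k \<noteq> 0"
  shows "\<mu> (gen_cone x) = (\<Sum>i\<in>S. sgn (\<beta> i) * \<mu> (gen_cone (x(i := b))))"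
proof -
  \<comment> \<open>The value 1 outside \<open>S\<close> leaves the other generators alone and keeps
    all scaling factors nonzero.\<close>
  define \<gamma> where "\<gamma> k = (if k \<in> S then \<beta> k else 1)" for k
  have \<gamma>: "\<gamma> k \<noteq> 0" for k
    using \<beta> by (simp add: \<gamma>_def)
  let ?y = "\<lambda>k. \<gamma> k *\<^sub>R x k" and ?s = "\<Prod>k\<in>UNIV. sgn (\<gamma> k)"
  have y_sum: "(\<Sum>k\<in>S. ?y k) = b"
    unfolding b by (intro sum.cong) (auto simp: \<gamma>_def)
  have b_UNIV: "b = (\<Sum>k\<in>UNIV. (if k \<in> S then \<beta> k else 0) *\<^sub>R x k)"
    unfolding b by (intro sum.mono_neutral_cong_left) auto
  have upd: "\<mu> (gen_cone (?y(i := b))) = ?s * (sgn (\<beta> i) * \<mu> (gen_cone (x(i := b))))"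
    if "i \<in> S" for i
  proof -
    have "?y(i := b) = (\<lambda>k. (\<gamma>(i := 1)) k *\<^sub>R (x(i := b)) k)"
      by auto
    moreover have "lin_indep (x(i := b))"
      using lin_indep_update[OF x b_UNIV, of i] that \<beta> by simp
    ultimately have "\<mu> (gen_cone (?y(i := b)))
        = (\<Prod>k\<in>UNIV. sgn ((\<gamma>(i := 1)) k)) * \<mu> (gen_cone (x(i := b)))"
      using measure_scale[of "x(i := b)" "\<gamma>(i := 1)"] \<gamma> by (simp only:) simp
    also have "(\<Prod>k\<in>UNIV. sgn ((\<gamma>(i := 1)) k)) = (\<Prod>k\<in>UNIV - {i}. sgn (\<gamma> k))"
      by (intro prod.mono_neutral_cong_right) auto
    \<comment> \<open>The vector \<open>b\<close> is not rescaled, so the factor at \<open>i\<close>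
      is missing; since signs square to 1, omitting it amounts to multiplying by it.\<close>
    also have "\<dots> = ?s * sgn (\<beta> i)"
      using that \<beta> by (subst prod.remove[of UNIV i]) (auto simp: \<gamma>_def sgn_if)
    finally show ?thesis
      by (simp only: mult.assoc)
  qed
  have "?s * \<mu> (gen_cone x) = (\<Sum>i\<in>S. \<mu> (gen_cone (?y(i := b))))"
    using measure_stellar[OF S lin_indep_scale[OF x, of \<gamma>, OF \<gamma>]] measure_scale[OF x, of \<gamma>, OF \<gamma>]
    by (simp only: y_sum)
  also have "\<dots> = ?s * (\<Sum>i\<in>S. sgn (\<beta> i) * \<mu> (gen_cone (x(i := b))))"
    unfolding sum_distrib_left by (intro sum.cong refl upd)
  finally show ?thesis
    using \<gamma> by (simp add: sgn_eq_0_iff)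
qed

end

subsection \<open>Orthogonal frames and projections to faces\<close>

locale basis_family =
  fixes v :: "'n \<Rightarrow> real^'n::{finite,linorder}"
  assumes inj: "inj v" and indep: "independent (range v)"
begin

lemma lin_indep_v: "lin_indep v"
  using inj indep by (rule lin_indep_inj_independent)

lemma subspace_frame_flag: "subspace (frame_flag v \<pi> k)"
  by (simp add: frame_flag_def)

lemma frame_w_orthogonal: "z \<in> frame_flag v \<pi> k \<Longrightarrow> frame_w v \<pi> k \<bullet> z = 0"
  using orth_proj(2)[OF subspace_frame_flag] by (simp add: frame_w_def orthogonal_def)

lemma frame_w_in_span: "frame_w v \<pi> k \<in> span (v ` \<pi> ` {..k})"
proof -
  have "frame_flag v \<pi> k \<subseteq> span (v ` \<pi> ` {..k})"
    unfolding frame_flag_def by (intro span_mono) auto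
  then show ?thesis
    unfolding frame_w_def using orth_proj(1)[OF subspace_frame_flag]
    by (intro span_diff) (auto intro: span_base)
qed

text \<open>Otherwise \<open>v (\<pi> k)\<close> would lie in the span of the other basis
  vectors.\<close>

lemma frame_w_nonzero:
  assumes "bij \<pi>"
  shows "frame_w v \<pi> k \<noteq> 0"
proof
  assume "frame_w v \<pi> k = 0"
  then have "v (\<pi> k) \<in> frame_flag v \<pi> k"
    using orth_proj(1)[OF subspace_frame_flag] by (metis frame_w_def eq_iff_diff_eq_0)
  moreover have "(\<lambda>j. v (\<pi> j)) ` {..<k} \<subseteq> range v - {v (\<pi> k)}"
    using inj assms by (auto simp: inj_eq bij_is_inj)
  ultimately have "v (\<pi> k) \<in> span (range v - {v (\<pi> k)})"
    unfolding frame_flag_def using span_mono by blast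
  then show False
    using indep unfolding dependent_def by auto
qed

lemma frame_q_in_span: "frame_q v \<pi> k \<in> span (v ` \<pi> ` {..k})"
  unfolding frame_q_def by (intro span_scale frame_w_in_span)

lemma frame_q_orthogonal: "z \<in> span (v ` \<pi> ` {..<k}) \<Longrightarrow> frame_q v \<pi> k \<bullet> z = 0"
  using frame_w_orthogonal[of z \<pi> k] by (simp add: frame_q_def frame_flag_def image_image)

lemma frame_q_less:
  assumes "j < k"
  shows "frame_q v \<pi> k \<bullet> frame_q v \<pi> j = 0"
proof -
  have "span (v ` \<pi> ` {..j}) \<subseteq> span (v ` \<pi> ` {..<k})"
    using assms by (intro span_mono) auto
  then show ?thesis
    using frame_q_in_span by (intro frame_q_orthogonal) auto
qed

lemma frame_q_orthonormal:
  assumes "bij \<pi>"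
  shows "frame_q v \<pi> j \<bullet> frame_q v \<pi> k = (if j = k then 1 else 0)"
proof (cases j k rule: linorder_cases)
  case equal
  have "norm (frame_q v \<pi> k) = 1"
    using frame_w_nonzero[OF assms] by (simp add: frame_q_def)
  then show ?thesis
    using equal by (simp add: norm_eq_1)
qed (use frame_q_less[of j k] frame_q_less[of k j] in \<open>auto simp: inner_commute\<close>)

text \<open>The projection subtracted from \<open>v (\<pi> k)\<close> is orthogonal to
  \<open>?w\<close>, so the inner product with \<open>?w\<close> is its squared norm. This
  positivity lets signs of coefficients be read off from inner products with the frame.\<close>

lemma inner_frame_q_pos:
  assumes "bij \<pi>"
  shows "0 < v (\<pi> k) \<bullet> frame_q v \<pi> k"
proof -
  let ?w = "frame_w v \<pi> k"
  have "v (\<pi> k) \<bullet> ?w = ?w \<bullet> ?w"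
    using frame_w_orthogonal[OF orth_proj(1)[OF subspace_frame_flag], of \<pi> k]
    by (simp add: frame_w_def inner_diff_right inner_diff_left inner_commute)
  then show ?thesis
    using frame_w_nonzero[OF assms, of k] by (simp add: frame_q_def)
qed

end

section \<open>Orthonormal expansions and projections to faces\<close>

lemma orthogonal_matrix_columns:
  fixes e :: "'n::finite \<Rightarrow> real^'n"
  assumes "\<And>j k. e j \<bullet> e k = (if j = k then 1 else 0)"
  shows "orthogonal_matrix (\<chi> i k. e k $ i)"
  unfolding orthogonal_matrix
  using assms
  by (simp add: matrix_matrix_mult_def transpose_def mat_def vec_eq_iff inner_vec_def)

lemma orthonormal_expansion:
  fixes e :: "'n::finite \<Rightarrow> real^'n"
  assumes "\<And>j k. e j \<bullet> e k = (if j = k then 1 else 0)"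
  shows "u = (\<Sum>k\<in>UNIV. (u \<bullet> e k) *\<^sub>R e k)"
proof -
  let ?Q = "(\<chi> i k. e k $ i) :: real^'n^'n"
  have "?Q ** transpose ?Q = mat 1"
    using orthogonal_matrix_columns[OF assms] by (simp add: orthogonal_matrix_def)
  then have "u = ?Q *v (transpose ?Q *v u)"
    by (metis matrix_vector_mul_assoc matrix_vector_mul_lid)
  also have "\<dots> = (\<Sum>k\<in>UNIV. (u \<bullet> e k) *\<^sub>R e k)"
    by (simp add: vec_eq_iff matrix_vector_mult_def vector_matrix_mult_def transpose_def
        inner_vec_def mult.commute)
  finally show ?thesis .
qed

definition face_proj :: "('n \<Rightarrow> 'a::euclidean_space) \<Rightarrow> 'a \<Rightarrow> 'n set \<Rightarrow> 'a" where
  "face_proj v u S = orth_proj (span (v ` S)) u"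

lemma face_proj_in_span: "face_proj v u S \<in> span (v ` S)"
  unfolding face_proj_def by (rule orth_proj) simp

lemma face_proj_inner: "z \<in> span (v ` S) \<Longrightarrow> face_proj v u S \<bullet> z = u \<bullet> z"
  using orth_proj(2)[of "span (v ` S)" z u]
  by (simp add: face_proj_def orthogonal_def inner_diff_left)

lemma face_proj_unique:
  assumes "y \<in> span (v ` S)" "\<And>z. z \<in> span (v ` S) \<Longrightarrow> y \<bullet> z = u \<bullet> z"
  shows "y = face_proj v u S"
proof -
  let ?d = "y - face_proj v u S"
  have "?d \<in> span (v ` S)"
    by (intro span_diff assms(1) face_proj_in_span)
  then have "?d \<bullet> ?d = 0"
    using assms(2)[of ?d] face_proj_inner[of ?d v S u] by (simp add: inner_diff_left)
  then show ?thesis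
    by simp
qed

context basis_family
begin

text \<open>In the expansion of \<open>u\<close> in the frame, the terms up to \<open>k\<close> lie
  in the span and the later ones are orthogonal to it, so the partial sum is the projection.\<close>

lemma face_proj_flag:
  assumes "bij \<pi>"
  shows "face_proj v u (\<pi> ` {..k}) = (\<Sum>j\<le>k. (u \<bullet> frame_q v \<pi> j) *\<^sub>R frame_q v \<pi> j)"
proof (rule face_proj_unique[symmetric])
  let ?q = "frame_q v \<pi>"
  have "?q j \<in> span (v ` \<pi> ` {..k})" if "j \<le> k" for j
    using frame_q_in_span span_mono[of "v ` \<pi> ` {..j}" "v ` \<pi> ` {..k}"] that by fastforce
  then show "(\<Sum>j\<le>k. (u \<bullet> ?q j) *\<^sub>R ?q j) \<in> span (v ` \<pi> ` {..k})"
    by (intro span_sum span_scale) auto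
  fix z assume z: "z \<in> span (v ` \<pi> ` {..k})"
  have "?q j \<bullet> z = 0" if "\<not> j \<le> k" for j
    using z span_mono[of "v ` \<pi> ` {..k}" "v ` \<pi> ` {..<j}"] that
    by (intro frame_q_orthogonal) fastforce
  then have "(\<Sum>j\<in>UNIV. (u \<bullet> ?q j) * (?q j \<bullet> z)) = (\<Sum>j\<le>k. (u \<bullet> ?q j) * (?q j \<bullet> z))"
    by (intro sum.mono_neutral_right) auto
  moreover have "u \<bullet> z = (\<Sum>j\<in>UNIV. (u \<bullet> ?q j) * (?q j \<bullet> z))"
    by (subst orthonormal_expansion[of ?q u, OF frame_q_orthonormal[OF assms]])
      (simp add: inner_sum_left)
  ultimately show "(\<Sum>j\<le>k. (u \<bullet> ?q j) *\<^sub>R ?q j) \<bullet> z = u \<bullet> z"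
    by (simp add: inner_sum_left)
qed

text \<open>Pairing the expansion with \<open>frame_q v \<pi> m\<close> kills the generators at
  earlier positions and leaves the coefficient at \<open>\<pi> m\<close> times a positive number. As
  this frame vector lies in the span, the projection may be replaced by \<open>u\<close> in the
  pairing.\<close>

lemma sgn_face_proj_coeff:
  assumes "bij \<pi>" and \<beta>: "face_proj v u (\<pi> ` {..m}) = (\<Sum>i\<in>\<pi> ` {..m}. \<beta> i *\<^sub>R v i)"
  shows "sgn (\<beta> (\<pi> m)) = sgn (u \<bullet> frame_q v \<pi> m)"
proof -
  let ?q = "frame_q v \<pi> m"
  have "u \<bullet> ?q = (\<Sum>i\<in>\<pi> ` {..m}. \<beta> i * (v i \<bullet> ?q))"
    using face_proj_inner[OF frame_q_in_span[of \<pi> m], of u] by (simp add: \<beta> inner_sum_left)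
  also have "\<dots> = (\<Sum>j\<le>m. \<beta> (\<pi> j) * (v (\<pi> j) \<bullet> ?q))"
    using inj_on_subset[OF bij_is_inj[OF assms(1)] subset_UNIV] by (simp add: sum.reindex)
  also have "\<dots> = (\<Sum>j\<in>{m}. \<beta> (\<pi> j) * (v (\<pi> j) \<bullet> ?q))"
  proof (intro sum.mono_neutral_right ballI)
    fix j assume "j \<in> {..m} - {m}"
    then have "v (\<pi> j) \<in> span (v ` \<pi> ` {..<m})"
      by (intro span_base) auto
    then show "\<beta> (\<pi> j) * (v (\<pi> j) \<bullet> ?q) = 0"
      using frame_q_orthogonal by (simp add: inner_commute)
  qed auto
  finally show ?thesis
    using inner_frame_q_pos[OF assms(1), of m] by (simp add: sgn_mult)
qed

end

subsection \<open>Replacing the generators along flags\<close>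

text \<open>The state of the replacement procedure for the order \<open>\<pi>\<close> when exactly the positions in
  \<open>K\<close> still carry their original generators.\<close>

definition flag_family ::
    "('n \<Rightarrow> 'a::euclidean_space) \<Rightarrow> 'a \<Rightarrow> ('n::order \<Rightarrow> 'n) \<Rightarrow> 'n set \<Rightarrow> 'n \<Rightarrow> 'a" where
  "flag_family v u \<pi> K j = (if j \<in> K then v (\<pi> j) else face_proj v u (\<pi> ` {..j}))"

text \<open>The exchange puts the projection at position \<open>p\<close>, but it belongs at
  position \<open>m\<close>. Transposing the two positions restores the form of a flag family, with
  \<open>v (\<sigma> m)\<close> now at \<open>p\<close>.\<close>

lemma flag_family_swap:
  fixes m p :: "'n::linorder"
  assumes p: "p \<le> m"
  shows "(flag_family v u \<sigma> {..m})(p := face_proj v u (\<sigma> ` {..m})) \<circ> Transposition.transpose p m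
       = flag_family v u (\<sigma> \<circ> Transposition.transpose p m) {..<m}" (is "?L = ?R")
proof
  fix j
  \<comment> \<open>For positions from \<open>m\<close> on, the swap takes place inside the initial
    segment, so the faces projected to are unchanged.\<close>
  have *: "(\<lambda>i. \<sigma> (Transposition.transpose p m i)) ` {..j} = \<sigma> ` {..j}" if "m \<le> j"
  proof -
    have "Transposition.transpose p m ` {..j} = {..j}"
      using p that by (intro transpose_image_eq) auto
    then show ?thesis
      by (metis image_image)
  qed
  consider "j = m" | "j = p" "p \<noteq> m" | "j \<noteq> m" "j \<noteq> p"
    by blast
  then show "?L j = ?R j"
    by cases (use p * in \<open>auto simp: flag_family_def\<close>)
qed

section \<open>Reindexing, and permutations that agree beyond a position\<close>

lemma gen_cone_comp_bij: "bij f \<Longrightarrow> gen_cone (x \<circ> f) = gen_cone x"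
  unfolding gen_cone_def by (metis bij_is_surj image_comp)

lemma span_image_coeffs:
  fixes v :: "'i::finite \<Rightarrow> 'a::real_vector"
  assumes "inj v" "y \<in> span (v ` S)"
  obtains \<gamma> where "y = (\<Sum>i\<in>S. \<gamma> i *\<^sub>R v i)"
proof -
  obtain c where "y = (\<Sum>z\<in>v ` S. c z *\<^sub>R z)"
    using assms(2) span_finite[of "v ` S"] by auto
  also have "\<dots> = (\<Sum>i\<in>S. c (v i) *\<^sub>R v i)"
    using inj_on_subset[OF assms(1) subset_UNIV] by (simp add: sum.reindex)
  finally show ?thesis
    by (rule that)
qed

lemma permutes_UNIV_iff_bij: "\<pi> permutes UNIV \<longleftrightarrow> bij \<pi>"
  by (metis UNIV_I bij_imp_permutes permutes_bij)

text \<open>The permutations are sorted by their value at \<open>m\<close>, written as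
  \<open>\<sigma> p\<close>. Here \<open>p \<le> m\<close> because the values of
  \<open>\<sigma>\<close> beyond \<open>m\<close> are already taken by \<open>\<pi>\<close>
  there.\<close>

lemma permutations_split_at:
  fixes \<sigma> :: "'n::linorder \<Rightarrow> 'n"
  assumes "bij \<sigma>"
  shows "{\<pi>. bij \<pi> \<and> (\<forall>j>m. \<pi> j = \<sigma> j)}
       = (\<Union>p\<le>m. {\<pi>. bij \<pi> \<and> (\<forall>j\<ge>m. \<pi> j = (\<sigma> \<circ> Transposition.transpose p m) j)})"
proof (intro set_eqI iffI)
  fix \<pi> assume "\<pi> \<in> {\<pi>. bij \<pi> \<and> (\<forall>j>m. \<pi> j = \<sigma> j)}"
  then have \<pi>: "bij \<pi>" "\<And>j. m < j \<Longrightarrow> \<pi> j = \<sigma> j"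
    by auto
  obtain p where p: "\<sigma> p = \<pi> m"
    using assms by (metis bij_pointE)
  have "p \<le> m"
    using p \<pi> by (metis bij_is_inj injD linorder_le_less_linear less_irrefl)
  moreover have "\<pi> j = (\<sigma> \<circ> Transposition.transpose p m) j" if "m \<le> j" for j
    using that p \<pi>(2)[of j] \<open>p \<le> m\<close> by (cases "j = m") (auto simp: Transposition.transpose_def)
  ultimately show "\<pi> \<in> (\<Union>p\<le>m. {\<pi>. bij \<pi> \<and> (\<forall>j\<ge>m. \<pi> j = (\<sigma> \<circ> Transposition.transpose p m) j)})"
    using \<pi>(1) by auto
qed (auto simp: Transposition.transpose_def)

lemma image_atMost_eq:
  fixes \<pi> \<sigma> :: "'n::linorder \<Rightarrow> 'n"
  assumes "bij \<pi>" "bij \<sigma>" "\<And>j. m < j \<Longrightarrow> \<pi> j = \<sigma> j"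
  shows "\<pi> ` {..m} = \<sigma> ` {..m}"
proof -
  have "\<pi> ` {m<..} = \<sigma> ` {m<..}"
    using assms(3) by (intro image_cong) auto
  then have "\<pi> ` (- {m<..}) = \<sigma> ` (- {m<..})"
    using assms(1,2) by (metis bij_image_Compl_eq)
  then show ?thesis
    by (simp add: Compl_greaterThan)
qed

section \<open>Iterating the exchange relation\<close>

locale basis_family_valuation = basis_family v + simple_cone_valuation \<mu>
  for v :: "'n \<Rightarrow> real^'n::{finite,linorder}" and \<mu> :: "(real^'n::{finite,linorder}) set \<Rightarrow> real" +
  fixes u :: "real^'n::{finite,linorder}"
  assumes gen: "generic v u"
begin

text \<open>One exchange, with \<open>b\<close> the projection of \<open>u\<close> to the span of
  the remaining generators. That span is the same for all permutations agreeing with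
  \<open>\<sigma>\<close> beyond \<open>m\<close>, so the sign at position \<open>m\<close> depends
  only on the index \<open>\<pi> m\<close>; the function \<open>s\<close> records it.\<close>

lemma measure_flag_step:
  assumes \<sigma>: "bij \<sigma>" and x: "lin_indep (flag_family v u \<sigma> {..m})"
  obtains s where "\<And>p. p \<le> m \<Longrightarrow> lin_indep (flag_family v u (\<sigma> \<circ> Transposition.transpose p m) {..<m})"
    and "\<And>\<pi>. bij \<pi> \<Longrightarrow> \<forall>j>m. \<pi> j = \<sigma> j \<Longrightarrow> sgn (u \<bullet> frame_q v \<pi> m) = s (\<pi> m)"
    and "\<mu> (gen_cone (flag_family v u \<sigma> {..m})) =
      (\<Sum>p\<le>m. s (\<sigma> p) * \<mu> (gen_cone (flag_family v u (\<sigma> \<circ> Transposition.transpose p m) {..<m})))"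
proof -
  let ?b = "face_proj v u (\<sigma> ` {..m})" and ?x = "flag_family v u \<sigma> {..m}"
  obtain \<gamma> where \<gamma>: "?b = (\<Sum>i\<in>\<sigma> ` {..m}. \<gamma> i *\<^sub>R v i)"
    using inj face_proj_in_span by (rule span_image_coeffs)
  have sgn_\<gamma>: "sgn (u \<bullet> frame_q v \<pi> m) = sgn (\<gamma> (\<pi> m))"
    if "bij \<pi>" "\<forall>j>m. \<pi> j = \<sigma> j" for \<pi>
  proof -
    have "\<pi> ` {..m} = \<sigma> ` {..m}"
      using that \<sigma> by (intro image_atMost_eq) auto
    then show ?thesis
      using sgn_face_proj_coeff[OF that(1), where u = u and m = m and \<beta> = \<gamma>] \<gamma> by simp
  qed
  \<comment> \<open>Genericity is applied to the permutation that moves the generator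
    \<open>v (\<sigma> p)\<close> to position \<open>m\<close>, where its coefficient has the sign
    of an inner product with a frame vector.\<close>
  have \<gamma>_nz: "\<gamma> (\<sigma> p) \<noteq> 0" if "p \<le> m" for p
  proof -
    have bij: "bij (\<sigma> \<circ> Transposition.transpose p m)"
      using \<sigma> by (intro bij_comp) auto
    then have "u \<bullet> frame_q v (\<sigma> \<circ> Transposition.transpose p m) m \<noteq> 0"
      using gen by (simp add: generic_def permutes_UNIV_iff_bij)
    moreover have "\<forall>j>m. (\<sigma> \<circ> Transposition.transpose p m) j = \<sigma> j"
      using that by (auto simp: Transposition.transpose_def)
    ultimately show ?thesis
      using sgn_\<gamma>[OF bij] by (auto simp: sgn_0_0)
  qed
  have b: "?b = (\<Sum>p\<le>m. \<gamma> (\<sigma> p) *\<^sub>R ?x p)"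
    unfolding \<gamma> using inj_on_subset[OF bij_is_inj[OF \<sigma>] subset_UNIV]
    by (simp add: sum.reindex flag_family_def)
  then have "?b = (\<Sum>p\<in>UNIV. (if p \<le> m then \<gamma> (\<sigma> p) else 0) *\<^sub>R ?x p)"
    unfolding b by (intro sum.mono_neutral_cong_left) auto
  from lin_indep_update[OF x this]
  have "lin_indep (?x(p := ?b))" if "p \<le> m" for p
    using that \<gamma>_nz by simp
  then have "lin_indep (flag_family v u (\<sigma> \<circ> Transposition.transpose p m) {..<m})" if "p \<le> m" for p
    using that lin_indep_bij[of "?x(p := ?b)" "Transposition.transpose p m"]
    by (simp add: flag_family_swap)
  moreover have "\<mu> (gen_cone ?x) =
      (\<Sum>p\<le>m. sgn (\<gamma> (\<sigma> p)) * \<mu> (gen_cone (?x(p := ?b))))"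
    using \<gamma>_nz by (intro measure_exchange[OF _ x b]) auto
  moreover have "gen_cone (?x(p := ?b)) = gen_cone (flag_family v u (\<sigma> \<circ> Transposition.transpose p m) {..<m})"
    if "p \<le> m" for p
    using gen_cone_comp_bij[of "Transposition.transpose p m" "?x(p := ?b)"] that by (simp add: flag_family_swap)
  ultimately show thesis
    using sgn_\<gamma> by (intro that[of "\<lambda>i. sgn (\<gamma> i)"]) auto
qed

text \<open>Induction on the number of positions not yet replaced. A down-closed \<open>K\<close> is
  empty, which is the final state, or of the form \<open>{..m}\<close>. After one exchange the
  induction hypothesis treats \<open>{..<m}\<close>, and the resulting double sum runs over the
  permutations sorted by their value at \<open>m\<close>.\<close>

lemma measure_flag_family:
  assumes "bij \<sigma>" "\<And>i j. j \<in> K \<Longrightarrow> i \<le> j \<Longrightarrow> i \<in> K" "lin_indep (flag_family v u \<sigma> K)"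
  shows "\<mu> (gen_cone (flag_family v u \<sigma> K)) =
    (\<Sum>\<pi> | bij \<pi> \<and> (\<forall>j. j \<notin> K \<longrightarrow> \<pi> j = \<sigma> j).
      (\<Prod>j\<in>K. sgn (u \<bullet> frame_q v \<pi> j)) * \<mu> (gen_cone (flag_family v u \<pi> {})))"
  using assms
proof (induction "card K" arbitrary: K \<sigma> rule: less_induct)
  case less
  note \<sigma> = less.prems(1)
  show ?case
  proof (cases "K = {}")
    case True
    then have "{\<pi>. bij \<pi> \<and> (\<forall>j. j \<notin> K \<longrightarrow> \<pi> j = \<sigma> j)} = {\<sigma>}"
      using \<sigma> by auto
    then show ?thesis
      using True by simp
  next
    case False
    define m where "m = Max K"
    have "m \<in> K" "\<And>j. j \<in> K \<Longrightarrow> j \<le> m"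
      using False by (simp_all add: m_def)
    then have K: "K = {..m}"
      using less.prems(2) by blast
    let ?\<sigma> = "\<lambda>p. \<sigma> \<circ> Transposition.transpose p m"
    let ?\<Pi> = "\<lambda>p. {\<pi>. bij \<pi> \<and> (\<forall>j\<ge>m. \<pi> j = ?\<sigma> p j)}"
    let ?f = "\<lambda>K \<pi>. (\<Prod>j\<in>K. sgn (u \<bullet> frame_q v \<pi> j)) * \<mu> (gen_cone (flag_family v u \<pi> {}))"
    obtain s where s: "\<And>p. p \<le> m \<Longrightarrow> lin_indep (flag_family v u (?\<sigma> p) {..<m})"
      "\<And>\<pi>. bij \<pi> \<Longrightarrow> \<forall>j>m. \<pi> j = \<sigma> j \<Longrightarrow> sgn (u \<bullet> frame_q v \<pi> m) = s (\<pi> m)"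
      "\<mu> (gen_cone (flag_family v u \<sigma> {..m})) =
        (\<Sum>p\<le>m. s (\<sigma> p) * \<mu> (gen_cone (flag_family v u (?\<sigma> p) {..<m})))"
      using measure_flag_step[OF \<sigma>, of m] less.prems(3) unfolding K by blast
    have f: "?f {..m} \<pi> = s (\<sigma> p) * ?f {..<m} \<pi>" if "p \<le> m" "\<pi> \<in> ?\<Pi> p" for p \<pi>
    proof -
      have "\<pi> m = \<sigma> p" "\<forall>j>m. \<pi> j = \<sigma> j"
        using that by (auto simp: Transposition.transpose_def)
      then have "sgn (u \<bullet> frame_q v \<pi> m) = s (\<sigma> p)"
        using s(2)[of \<pi>] that by simp
      moreover have "{..m} = insert m {..<m}"
        by auto
      ultimately show ?thesis
        by simp
    qed
    have IH: "\<mu> (gen_cone (flag_family v u (?\<sigma> p) {..<m})) = (\<Sum>\<pi>\<in>?\<Pi> p. ?f {..<m} \<pi>)"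
      if "p \<le> m" for p
    proof -
      have "card {..<m} < card K"
        unfolding K by (intro psubset_card_mono) auto
      moreover have "bij (?\<sigma> p)"
        using \<sigma> by (intro bij_comp) auto
      ultimately show ?thesis
        using less.hyps[of "{..<m}" "?\<sigma> p"] s(1)[OF that] by (simp add: not_less)
    qed
    have "\<mu> (gen_cone (flag_family v u \<sigma> K)) = (\<Sum>p\<le>m. \<Sum>\<pi>\<in>?\<Pi> p. ?f {..m} \<pi>)"
      unfolding K s(3) by (intro sum.cong refl) (simp only: IH f sum_distrib_left atMost_iff cong: sum.cong)
    also have "\<dots> = (\<Sum>\<pi>\<in>(\<Union>p\<le>m. ?\<Pi> p). ?f {..m} \<pi>)"
    proof (rule sum.UNION_disjoint[symmetric])
      \<comment> \<open>Permutations in different classes differ in their value at \<open>m\<close>,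
        which is \<open>\<sigma> p\<close>.\<close>
      show "\<forall>p\<in>{..m}. \<forall>p'\<in>{..m}. p \<noteq> p' \<longrightarrow> ?\<Pi> p \<inter> ?\<Pi> p' = {}"
      proof (intro ballI impI)
        fix p p' :: 'n assume "p \<noteq> p'"
        then have "?\<sigma> p m \<noteq> ?\<sigma> p' m"
          using \<sigma> by (simp add: bij_is_inj inj_eq)
        then show "?\<Pi> p \<inter> ?\<Pi> p' = {}"
          by (auto simp del: comp_apply)
      qed
    qed auto
    also have "(\<Union>p\<le>m. ?\<Pi> p) = {\<pi>. bij \<pi> \<and> (\<forall>j. j \<notin> K \<longrightarrow> \<pi> j = \<sigma> j)}"
      unfolding permutations_split_at[OF \<sigma>, symmetric] K by (auto simp: not_le)
    finally show ?thesis
      unfolding K .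
  qed
qed

lemma measure_pos_range_basis:
  "\<mu> (pos (range v)) = (\<Sum>\<pi> | \<pi> permutes UNIV.
    (\<Prod>j\<in>UNIV. sgn (u \<bullet> frame_q v \<pi> j)) * \<mu> (gen_cone (\<lambda>k. face_proj v u (\<pi> ` {..k}))))"
proof -
  have "flag_family v u id UNIV = v" "flag_family v u \<pi> {} = (\<lambda>k. face_proj v u (\<pi> ` {..k}))" for \<pi>
    by (auto simp: flag_family_def)
  then show ?thesis
    using measure_flag_family[of id UNIV] lin_indep_v
    by (simp add: gen_cone_def permutes_UNIV_iff_bij)
qed

end

subsection \<open>Orthoscheme cones\<close>

lemma orthoscheme_generator_nth: "orthoscheme_generator a i $ k = (if k \<le> i then a $ k else 0)"
proof -
  have "orthoscheme_generator a i $ k = (\<Sum>j\<le>i. if j = k then a $ j else 0)"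
    by (simp add: orthoscheme_generator_def axis_def if_distrib eq_commute cong: if_cong)
  then show ?thesis
    by simp
qed

text \<open>The orthogonal matrix with columns \<open>e k\<close> carries the orthoscheme generators
  to these partial sums.\<close>

lemma orthonormal_image_orthoscheme_cone:
  fixes e :: "'n \<Rightarrow> real^'n::{finite,linorder}"
  assumes "orthogonal_invariant \<mu>" and e: "\<And>j k. e j \<bullet> e k = (if j = k then 1 else 0)"
  shows "\<mu> (gen_cone (\<lambda>k. \<Sum>j\<le>k. (a $ j) *\<^sub>R e j)) = \<mu> (orthoscheme_cone a)"
proof -
  let ?M = "(\<chi> i k. e k $ i) :: real^'n::{finite,linorder}^'n::{finite,linorder}"
  have "?M *v orthoscheme_generator a k = (\<Sum>j\<le>k. (a $ j) *\<^sub>R e j)" for k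
  proof -
    have "(?M *v orthoscheme_generator a k) $ i = (\<Sum>j\<le>k. a $ j * e j $ i)" for i
      unfolding matrix_vector_mult_def
      by (simp add: orthoscheme_generator_nth) (intro sum.mono_neutral_cong_right; auto)
    then show ?thesis
      by (simp add: vec_eq_iff)
  qed
  then have "gen_cone (\<lambda>k. \<Sum>j\<le>k. (a $ j) *\<^sub>R e j) = (\<lambda>x. ?M *v x) ` orthoscheme_cone a"
    by (simp add: gen_cone_def orthoscheme_cone_def image_image flip: pos_linear_image)
  moreover have "orthoscheme_cone a \<in> polyhedral_cones"
    by (simp add: orthoscheme_cone_def)
  ultimately show ?thesis
    using assms(1) orthogonal_matrix_columns[OF e] unfolding orthogonal_invariant_def by metis
qed

theorem theorem4p3:
  fixes v :: "'n \<Rightarrow> real^'n::{finite,linorder}"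
    and \<mu> :: "(real^'n::{finite,linorder}) set \<Rightarrow> real"
    and \<psi> :: "real^'n::{finite,linorder} \<Rightarrow> real"
    and u :: "real^'n::{finite,linorder}"
  assumes basis: "inj v" "independent (range v)" "span (range v) = UNIV"
    and val: "cone_valuation \<mu>"
    and inv: "orthogonal_invariant \<mu>"
    and vanish: "\<And>D. D \<in> polyhedral_cones \<Longrightarrow> dim D < CARD('n) \<or> contains_line D \<Longrightarrow> \<mu> D = 0"
    and psi: "\<And>a. (\<forall>i. 0 < a $ i) \<Longrightarrow> \<psi> a = \<mu> (orthoscheme_cone a)"
    and gen: "generic v u"
  shows "\<mu> (pos (range v)) =
    (\<Sum>\<pi> | \<pi> permutes UNIV.
       (\<Prod>k\<in>UNIV. sgn ((transpose (frame_Q v \<pi>) *v u) $ k)) *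
       \<psi> \<bar>transpose (frame_Q v \<pi>) *v u\<bar>)"
proof -
  interpret basis_family_valuation v \<mu> u
    by unfold_locales (use basis val vanish gen in auto)
  have a: "(transpose (frame_Q v \<pi>) *v u) $ k = u \<bullet> frame_q v \<pi> k" for \<pi> k
    by (simp add: matrix_vector_mult_def transpose_def frame_Q_def inner_vec_def mult.commute)
  have "\<mu> (gen_cone (\<lambda>k. face_proj v u (\<pi> ` {..k}))) = \<psi> \<bar>transpose (frame_Q v \<pi>) *v u\<bar>"
    if \<pi>: "\<pi> permutes UNIV" for \<pi>
  proof -
    let ?a = "\<bar>transpose (frame_Q v \<pi>) *v u\<bar>"
    \<comment> \<open>The signs are moved into the frame: it stays orthonormal, while the
      coefficients become the positive numbers
      \<open>\<bar>u \<bullet> frame_q v \<pi> k\<bar>\<close>, at which \<open>\<psi>\<close> is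
      prescribed.\<close>
    let ?e = "\<lambda>k. sgn (u \<bullet> frame_q v \<pi> k) *\<^sub>R frame_q v \<pi> k"
    have bij: "bij \<pi>"
      using \<pi> by (rule permutes_bij)
    have nz: "u \<bullet> frame_q v \<pi> k \<noteq> 0" for k
      using gen \<pi> by (simp add: generic_def)
    have abs_a: "?a $ k = \<bar>u \<bullet> frame_q v \<pi> k\<bar>" for k
      by (simp add: abs_vec_def a del: transpose_matrix_vector)
    have "?e j \<bullet> ?e k = (if j = k then 1 else 0)" for j k
      using nz[of k] by (simp add: frame_q_orthonormal[OF bij] sgn_if)
    from orthonormal_image_orthoscheme_cone[OF inv this, of ?a]
    have "\<mu> (orthoscheme_cone ?a) = \<mu> (gen_cone (\<lambda>k. \<Sum>j\<le>k. (u \<bullet> frame_q v \<pi> j) *\<^sub>R frame_q v \<pi> j))"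
      by (simp add: abs_a abs_mult_sgn del: transpose_matrix_vector)
    then show ?thesis
      using psi[of ?a] nz by (simp add: abs_a face_proj_flag[OF bij] del: transpose_matrix_vector)
  qed
  then show ?thesis
    unfolding measure_pos_range_basis a by (intro sum.cong) (auto simp del: transpose_matrix_vector)
qed

end
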